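(* Let $A\in\mathbb{R}^{n\times n}$ be symmetric positive semidefinite with eigenvalues $\lambda_1\le\cdots\le\lambda_n$, $\lambda_1<\lambda_n$, let $\mathbf{b}\in\mathbb{R}^n$, $\Delta>0$, and $f(\mathbf{x})=\frac12\mathbf{x}^TA\mathbf{x}-\mathbf{b}^T\mathbf{x}$. Let $\mathbf{x}^*$ minimize $f$ over $\{\mathbf{x}:\|\mathbf{x}\|\le\Delta\}$, and suppose the associated KKT multiplier $\mu^*$ is positive, i.e. $\mu^*>0$, $(A+\mu^*I)\mathbf{x}^*=\mathbf{b}$ and $\|\mathbf{x}^*\|=\Delta$. Let $\mathbf{x}_0=\mathbf{0}$ and, for $k\ge1$, let $\mathbf{x}_k$ be the $k$th iterate of the trust-region Lanczos method, i.e. a minimizer of $f$ over $\{\mathbf{x}\in\mathrm{span}\{\mathbf{b},A\mathbf{b},\ldots,A^{k-1}\mathbf{b}\}:\|\mathbf{x}\|\le\Delta\}$. Then for all $k\ge1$, $$f(\mathbf{x}_k)-f(\mathbf{x}^* )\le 6c_k\,(f(\mathbf{x}_0)-f(\mathbf{x}^* )),$$ where $c_k$ is the constant defined in the context and satisfies $$c_k\le2\left(\frac{\zeta-1}{\zeta+1}\right)^k,\qquad \zeta=\sqrt{\frac{\lambda_n+\mu^*}{\lambda_1+\mu^*}}.$$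
   Context: Let $T_k$ be the degree-$k$ Chebyshev polynomial of the first kind, and let $\hat T_k=1+T_k$ if $k$ is even and $\hat T_k=1-T_k$ if $k$ is odd. The constant $c_k$ is the normalizing constant for which the polynomial $q^{\mathrm{A}}(t)=c_k\hat T_k\left(\frac{2t-(\lambda_1+\lambda_n+2\mu^* )}{\lambda_n-\lambda_1}\right)$ satisfies $q^{\mathrm{A}}(0)=1$. *)

theory Defs
  imports "HOL-Analysis.Analysis" "HOL-Computational_Algebra.Polynomial"
begin

definition symmetric_psd :: "real ^ 'n ^ 'n \<Rightarrow> bool" where
  "symmetric_psd A \<longleftrightarrow> transpose A = A \<and> (\<forall>v. 0 \<le> v \<bullet> (A *v v))"

text \<open>The eigenvalues are listed in increasing order as \<open>lam 1, \<dots>, lam n\<close> with \<open>n = CARD('n)\<close>,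
  each repeated according to its multiplicity as a root of the characteristic polynomial.\<close>

definition sorted_eigenvalues :: "real ^ 'n ^ 'n \<Rightarrow> (nat \<Rightarrow> real) \<Rightarrow> bool" where
  "sorted_eigenvalues A lam \<longleftrightarrow>
     mono_on {1..CARD('n)} lam \<and>
     (\<forall>t. det (mat t - A) = (\<Prod>i\<in>{1..CARD('n)}. t - lam i))"

definition quad_obj :: "real ^ 'n ^ 'n \<Rightarrow> real ^ 'n \<Rightarrow> real ^ 'n \<Rightarrow> real" where
  "quad_obj A b x = 1 / 2 * (x \<bullet> (A *v x)) - b \<bullet> x"

definition krylov :: "nat \<Rightarrow> real ^ 'n ^ 'n \<Rightarrow> real ^ 'n \<Rightarrow> (real ^ 'n) set" where
  "krylov k A b = span ((\<lambda>j. (((*v) A) ^^ j) b) ` {..<k})"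

definition trs_solution :: "real ^ 'n ^ 'n \<Rightarrow> real ^ 'n \<Rightarrow> real \<Rightarrow> real ^ 'n \<Rightarrow> bool" where
  "trs_solution A b \<Delta> x \<longleftrightarrow> is_arg_min (quad_obj A b) (\<lambda>y. norm y \<le> \<Delta>) x"

definition trs_lanczos_iterate ::
    "nat \<Rightarrow> real ^ 'n ^ 'n \<Rightarrow> real ^ 'n \<Rightarrow> real \<Rightarrow> real ^ 'n \<Rightarrow> bool" where
  "trs_lanczos_iterate k A b \<Delta> x \<longleftrightarrow>
     is_arg_min (quad_obj A b) (\<lambda>y. y \<in> krylov k A b \<and> norm y \<le> \<Delta>) x"

fun cheb_T :: "nat \<Rightarrow> real poly" where
  "cheb_T 0 = 1"
| "cheb_T (Suc 0) = [:0, 1:]"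
| "cheb_T (Suc (Suc k)) = [:0, 2:] * cheb_T (Suc k) - cheb_T k"

definition cheb_T_hat :: "nat \<Rightarrow> real poly" where
  "cheb_T_hat k = (if even k then 1 + cheb_T k else 1 - cheb_T k)"

text \<open>The polynomial \<open>q\<close> with an arbitrary scalar factor \<open>c\<close>; \<open>l\<close>, \<open>u\<close> and \<open>\<mu>\<close> stand for
  \<open>\<lambda>\<^sub>1\<close>, \<open>\<lambda>\<^sub>n\<close> and the multiplier.\<close>

definition qA :: "real \<Rightarrow> nat \<Rightarrow> real \<Rightarrow> real \<Rightarrow> real \<Rightarrow> real poly" where
  "qA c k l u \<mu> =
     smult c (pcompose (cheb_T_hat k) [:- (l + u + 2 * \<mu>) / (u - l), 2 / (u - l):])"

definition norm_const :: "nat \<Rightarrow> real \<Rightarrow> real \<Rightarrow> real \<Rightarrow> real" where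
  "norm_const k l u \<mu> = (THE c. poly (qA c k l u \<mu>) 0 = 1)"

lemma poly_qA:
  assumes "l < u"
  shows "poly (qA c k l u \<mu>) t =
    c * poly (cheb_T_hat k) ((2 * t - (l + u + 2 * \<mu>)) / (u - l))"
proof -
  have "(- (l + u + 2 * \<mu>)) / (u - l) + t * (2 / (u - l)) = (2 * t - (l + u + 2 * \<mu>)) / (u - l)"
    by (simp add: add_divide_distrib diff_divide_distrib minus_divide_left[symmetric] algebra_simps)
  then show ?thesis by (simp add: qA_def poly_pcompose)
qed

lemma cheb_T_neg: "poly (cheb_T k) (- s) = (- 1) ^ k * poly (cheb_T k) s"
  by (induction k rule: cheb_T.induct) (auto simp: algebra_simps)

lemma cheb_T_ge_1:
  assumes "1 \<le> s"
  shows "1 \<le> poly (cheb_T k) s \<and> poly (cheb_T k) s \<le> poly (cheb_T (Suc k)) s"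
proof (induction k)
  case 0
  then show ?case using assms by simp
next
  case (Suc k)
  let ?a = "poly (cheb_T k) s" and ?b = "poly (cheb_T (Suc k)) s"
  have "1 * ?b \<le> s * ?b" using Suc assms by (intro mult_right_mono) auto
  moreover have "poly (cheb_T (Suc (Suc k))) s = 2 * (s * ?b) - ?a" by simp
  ultimately show ?case using Suc by linarith
qed

text \<open>The normalising constant exists and is unique, so the definite description above
  denotes it.\<close>

lemma norm_const_unique:
  assumes "0 \<le> l" "l < u" "0 < \<mu>"
  shows "\<exists>!c. poly (qA c k l u \<mu>) 0 = 1"
proof -
  define s where "s = (l + u + 2 * \<mu>) / (u - l)"
  have s: "1 \<le> s" using assms by (simp add: s_def field_simps)
  have e: "(2 * 0 - (l + u + 2 * \<mu>)) / (u - l) = - s"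
    by (simp add: s_def minus_divide_left)
  have "poly (cheb_T_hat k) (- s) = 1 + poly (cheb_T k) s"
    by (simp add: cheb_T_hat_def cheb_T_neg)
  then have "poly (qA c k l u \<mu>) 0 = c * (1 + poly (cheb_T k) s)" for c
    unfolding poly_qA[OF assms(2)] e by simp
  moreover have "1 + poly (cheb_T k) s \<noteq> 0" using cheb_T_ge_1[OF s, of k] by linarith
  ultimately show ?thesis by (auto intro!: ex1I[of _ "1 / (1 + poly (cheb_T k) s)"] simp: field_simps)
qed

end

theory Submission
  imports Defs
begin

text \<open>Expand everything in an orthonormal eigenbasis of \<open>A\<close>. With \<open>h = a + \<mu>\<close> for an eigenvalue
  \<open>a\<close>, the vector \<open>y\<close> whose coordinates are those of \<open>x\<^sup>*\<close> damped by the factors \<open>1 - q h\<close>,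
  where \<open>q\<close> is the normalised shifted Chebyshev polynomial, lies in the Krylov space because
  \<open>q 0 = 1\<close> and \<open>b\<close> has coordinates \<open>h\<close> times those of \<open>x\<^sup>*\<close>. Since \<open>0 \<le> q h \<le> 2 c \<le> 1\<close>, \<open>y\<close> is
  feasible. The eigendirection of \<open>a\<close> contributes the squared coordinate of \<open>x\<^sup>*\<close> times
  \<open>a q\<^sup>2 / 2 + \<mu> q\<close> to \<open>f y - f x\<^sup>*\<close>, and times \<open>a / 2 + \<mu>\<close> to \<open>f 0 - f x\<^sup>*\<close>.\<close>

section \<open>Chebyshev polynomials on and outside the interval from -1 to 1\<close>

lemma poly_cheb_T_cos: "poly (cheb_T k) (cos \<theta>) = cos (real k * \<theta>)"
proof (induction k rule: cheb_T.induct)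
  case (3 k)
  have "cos (real (Suc (Suc k)) * \<theta>) = cos (real (Suc k) * \<theta> + \<theta>)"
    and "cos (real k * \<theta>) = cos (real (Suc k) * \<theta> - \<theta>)"
    by (simp_all add: algebra_simps)
  then have "cos (real (Suc (Suc k)) * \<theta>) = 2 * cos \<theta> * cos (real (Suc k) * \<theta>) - cos (real k * \<theta>)"
    by (simp add: cos_add cos_diff)
  with 3 show ?case by simp
qed simp_all

lemma abs_poly_cheb_T_le_1:
  assumes "\<bar>s\<bar> \<le> 1"
  shows "\<bar>poly (cheb_T k) s\<bar> \<le> 1"
  using poly_cheb_T_cos[of k "arccos s"] assms by (simp add: abs_le_iff)

text \<open>The Joukowski substitution makes growth beyond 1 explicit: in the recurrence the cross
  terms are \<open>r * z * (r ^ k + z ^ k)\<close>, which cancel the subtracted term because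
  \<open>r * z = 1\<close>.\<close>

lemma poly_cheb_T_Joukowski:
  assumes "r * z = 1"
  shows "poly (cheb_T k) ((r + z) / 2) = (r ^ k + z ^ k) / 2"
proof (induction k rule: cheb_T.induct)
  case (3 k)
  have "poly (cheb_T (Suc (Suc k))) ((r + z) / 2)
      = (r + z) * poly (cheb_T (Suc k)) ((r + z) / 2) - poly (cheb_T k) ((r + z) / 2)"
    by simp
  also have "\<dots> = ((r + z) * (r ^ Suc k + z ^ Suc k) - (r ^ k + z ^ k)) / 2"
    unfolding 3 by (simp add: diff_divide_distrib del: power_Suc)
  also have "(r + z) * (r ^ Suc k + z ^ Suc k) - (r ^ k + z ^ k)
      = r ^ Suc (Suc k) + z ^ Suc (Suc k) + (r * z - 1) * (r ^ k + z ^ k)"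
    by (simp add: algebra_simps)
  finally show ?case using assms by simp
qed simp_all

lemma degree_cheb_T_le: "degree (cheb_T k) \<le> k"
proof (induction k rule: cheb_T.induct)
  case (3 k)
  have "degree ([:0, 2:] * cheb_T (Suc k)) \<le> Suc (Suc k)"
    using degree_mult_le[of "[:0, 2:]" "cheb_T (Suc k)"] 3 by simp
  with 3 show ?case by (simp del: mult_pCons_left add: degree_diff_le)
qed simp_all

section \<open>Degree, normalisation and size of the shifted polynomial\<close>

lemma degree_qA_le: "degree (qA c k l u \<mu>) \<le> k"
proof -
  have "degree (cheb_T_hat k) \<le> k"
    by (auto simp: cheb_T_hat_def degree_cheb_T_le intro!: degree_add_le degree_diff_le)
  moreover have "degree (qA c k l u \<mu>) \<le>
      degree (cheb_T_hat k) * degree [:- (l + u + 2 * \<mu>) / (u - l), 2 / (u - l):]"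
    unfolding qA_def by (metis degree_pcompose degree_smult_le)
  moreover have "degree [:- (l + u + 2 * \<mu>) / (u - l), 2 / (u - l):] \<le> 1"
    by simp
  ultimately show ?thesis
    using mult_le_mono by fastforce
qed

text \<open>The affine map sends 0 to \<open>- s\<close> with \<open>s \<ge> 1\<close>, and the
  parity sign in \<open>cheb_T_hat\<close> undoes the sign of \<open>T_k (- s)\<close>, so the value
  to normalise is \<open>1 + T_k s \<ge> 2\<close>.\<close>

lemma norm_const_eq:
  assumes "0 \<le> l" "l < u" "0 < \<mu>"
  shows "norm_const k l u \<mu> = 1 / (1 + poly (cheb_T k) ((l + u + 2 * \<mu>) / (u - l)))"
    and "0 < norm_const k l u \<mu>"
    and "2 * norm_const k l u \<mu> \<le> 1"
    and "poly (qA (norm_const k l u \<mu>) k l u \<mu>) 0 = 1"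
proof -
  define s where "s = (l + u + 2 * \<mu>) / (u - l)"
  have T: "1 \<le> poly (cheb_T k) s"
    using cheb_T_ge_1[of s k] assms by (simp add: s_def field_simps)
  have e: "(2 * 0 - (l + u + 2 * \<mu>)) / (u - l) = - s"
    by (simp add: s_def minus_divide_left)
  show n: "poly (qA (norm_const k l u \<mu>) k l u \<mu>) 0 = 1"
    unfolding norm_const_def by (rule theI'[OF norm_const_unique[OF assms]])
  have "poly (cheb_T_hat k) (- s) = 1 + poly (cheb_T k) s"
    by (simp add: cheb_T_hat_def cheb_T_neg)
  with n have "norm_const k l u \<mu> * (1 + poly (cheb_T k) s) = 1"
    unfolding poly_qA[OF assms(2)] e by simp
  with T have eq: "norm_const k l u \<mu> = 1 / (1 + poly (cheb_T k) s)"
    by (simp add: field_simps)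
  then show "norm_const k l u \<mu> = 1 / (1 + poly (cheb_T k) ((l + u + 2 * \<mu>) / (u - l)))"
    by (simp add: s_def)
  show "0 < norm_const k l u \<mu>" "2 * norm_const k l u \<mu> \<le> 1"
    using T by (simp_all add: eq)
qed

text \<open>At the Joukowski point for \<open>r\<close> the denominator is
  \<open>1 + (r ^ k + 1 / r ^ k) / 2\<close>; keeping only \<open>r ^ k / 2\<close> leaves
  \<open>2 / r ^ k\<close>.\<close>

lemma norm_const_le:
  assumes "0 \<le> l" "l < u" "0 < \<mu>" and \<zeta>: "\<zeta> = sqrt ((u + \<mu>) / (l + \<mu>))"
  shows "norm_const k l u \<mu> \<le> 2 * ((\<zeta> - 1) / (\<zeta> + 1)) ^ k"
proof -
  have z1: "\<zeta> > 1" using assms by simp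
  have z2: "\<zeta>\<^sup>2 = (u + \<mu>) / (l + \<mu>)" using assms by simp
  \<comment> \<open>The solution above 1 of \<open>(r + 1 / r) / 2 = (\<zeta>\<^sup>2 + 1) /
    (\<zeta>\<^sup>2 - 1)\<close>.\<close>
  define r where "r = (\<zeta> + 1) / (\<zeta> - 1)"
  have r: "r > 0" using z1 by (simp add: r_def)
  have "(l + u + 2 * \<mu>) / (u - l) = (\<zeta>\<^sup>2 + 1) / (\<zeta>\<^sup>2 - 1)"
  proof -
    have "\<zeta>\<^sup>2 + 1 = (l + u + 2 * \<mu>) / (l + \<mu>)" "\<zeta>\<^sup>2 - 1 = (u - l) / (l + \<mu>)"
      unfolding z2 using assms(1,3) by (simp_all add: divide_simps)
    then show ?thesis using assms(1,3) by simp
  qed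
  also have "\<dots> = (r + 1 / r) / 2"
  proof -
    have "\<zeta>\<^sup>2 - 1 = (\<zeta> - 1) * (\<zeta> + 1)" by (simp add: power2_eq_square algebra_simps)
    then show ?thesis
      using z1 unfolding r_def by (simp add: divide_simps) (simp add: power2_eq_square algebra_simps)
  qed
  finally have s: "(l + u + 2 * \<mu>) / (u - l) = (r + 1 / r) / 2" .
  define w where "w = (1 / r) ^ k"
  have w: "w > 0" "r ^ k = 1 / w" using r by (simp_all add: w_def power_one_over)
  have le: "1 / (1 + (t + w) / 2) \<le> 1 / (t / 2)" if "t > 0" for t
    using that w(1) by (intro divide_left_mono mult_pos_pos) (auto simp: add_divide_distrib add_pos_pos)
  have "norm_const k l u \<mu> = 1 / (1 + (1 / w + w) / 2)"
    unfolding norm_const_eq(1)[OF assms(1-3)] s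
    using poly_cheb_T_Joukowski[of r "1 / r" k] r w by (simp add: w_def)
  also have "\<dots> \<le> 1 / ((1 / w) / 2)" using le[of "1 / w"] w(1) by simp
  also have "\<dots> = 2 * w" by simp
  also have "w = ((\<zeta> - 1) / (\<zeta> + 1)) ^ k" by (simp add: w_def r_def)
  finally show ?thesis .
qed

text \<open>The affine map carries the shifted spectral interval onto the interval from -1 to 1,
  where \<open>T_k\<close> has modulus at most 1; adding 1 to plus or minus \<open>T_k\<close> then
  gives values between 0 and 2.\<close>

lemma poly_qA_bounds:
  assumes "l < u" "0 \<le> c" "l + \<mu> \<le> t" "t \<le> u + \<mu>"
  shows "0 \<le> poly (qA c k l u \<mu>) t" "poly (qA c k l u \<mu>) t \<le> 2 * c"
proof -
  define s where "s = (2 * t - (l + u + 2 * \<mu>)) / (u - l)"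
  have "\<bar>s\<bar> \<le> 1" using assms by (simp add: s_def abs_le_iff field_simps)
  from abs_poly_cheb_T_le_1[OF this, of k]
  have *: "0 \<le> poly (cheb_T_hat k) s" "poly (cheb_T_hat k) s \<le> 2"
    by (auto simp: cheb_T_hat_def)
  have e: "poly (qA c k l u \<mu>) t = c * poly (cheb_T_hat k) s"
    unfolding poly_qA[OF assms(1)] s_def ..
  show "0 \<le> poly (qA c k l u \<mu>) t" using * assms by (simp add: e)
  show "poly (qA c k l u \<mu>) t \<le> 2 * c"
    using mult_left_mono[OF *(2) assms(2)] by (simp add: e mult.commute)
qed

section \<open>Spectral theorem for self-adjoint maps\<close>

text \<open>A maximiser \<open>v\<close> of the Rayleigh quotient on the unit sphere of
  \<open>S\<close> is an eigenvector: the residual \<open>w = M v - T v\<close> stays in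
  \<open>S\<close> by invariance, and moving from \<open>v\<close> along \<open>w\<close> would
  otherwise exceed the maximum.\<close>

lemma selfadjoint_eigenvector_in_subspace:
  fixes T :: "'a::euclidean_space \<Rightarrow> 'a"
  assumes T: "linear T" and sa: "\<And>x y. x \<bullet> T y = T x \<bullet> y"
    and S: "subspace S" "\<And>x. x \<in> S \<Longrightarrow> T x \<in> S" and ne: "S \<noteq> {0}"
  obtains v a where "v \<in> S" "norm v = 1" "T v = a *\<^sub>R v"
proof -
  let ?K = "sphere 0 1 \<inter> S"
  have "compact ?K"
    using closed_subspace[OF S(1)] by (simp add: compact_Int_closed)
  moreover obtain z where z: "z \<in> S" "z \<noteq> 0" using ne subspace_0[OF S(1)] by blast
  then have "z /\<^sub>R norm z \<in> ?K" using subspace_scale[OF S(1)] by simp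
  then have "?K \<noteq> {}" by blast
  moreover have "continuous_on ?K (\<lambda>x. x \<bullet> T x)"
    by (intro continuous_on_inner continuous_on_id linear_continuous_on linear_conv_bounded_linear[THEN iffD1] T)
  ultimately obtain v where v: "v \<in> ?K" and max: "\<And>x. x \<in> ?K \<Longrightarrow> x \<bullet> T x \<le> v \<bullet> T v"
    using continuous_attains_sup by metis
  define M where "M = v \<bullet> T v"
  have vS: "v \<in> S" and vv: "v \<bullet> v = 1" using v by (auto simp: dot_square_norm)
  have quad: "0 \<le> M * (x \<bullet> x) - x \<bullet> T x" if "x \<in> S" for x
  proof (cases "x = 0")
    case False
    have "x /\<^sub>R norm x \<in> ?K" using False that subspace_scale[OF S(1)] by simp
    from max[OF this] have "(x \<bullet> T x) / (norm x)\<^sup>2 \<le> M"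
      by (simp add: M_def linear_scale[OF T] divide_inverse power2_eq_square ac_simps)
    then show ?thesis using False by (simp add: divide_le_eq power2_norm_eq_inner)
  qed (simp add: linear_0[OF T])
  define w where "w = M *\<^sub>R v - T v"
  have wS: "w \<in> S" unfolding w_def using vS S subspace_diff subspace_scale by blast
  define p where "p = w \<bullet> w"
  define d where "d = M * (w \<bullet> w) - w \<bullet> T w"
  \<comment> \<open>This is \<open>quad\<close> at \<open>v + t w\<close>. The constant term
    vanishes since \<open>v\<close> attains \<open>M\<close>; self-adjointness turns the linear
    coefficient into \<open>2 * (w \<bullet> w)\<close>.\<close>
  have lin: "0 \<le> 2 * t * p + t\<^sup>2 * d" for t :: real
  proof -
    have "v + t *\<^sub>R w \<in> S" using vS wS S(1) by (simp add: subspace_add subspace_scale)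
    note quad[OF this]
    also have "M * ((v + t *\<^sub>R w) \<bullet> (v + t *\<^sub>R w)) - (v + t *\<^sub>R w) \<bullet> T (v + t *\<^sub>R w)
        = (M * (v \<bullet> v) - v \<bullet> T v) + 2 * t * (M * (v \<bullet> w) - T v \<bullet> w) + t\<^sup>2 * d"
      using sa[of v w] inner_commute[of w v] inner_commute[of w "T v"]
      by (simp add: d_def linear_add[OF T] linear_scale[OF T] inner_add_left inner_add_right)
        (simp add: algebra_simps power2_eq_square)
    also have "M * (v \<bullet> w) - T v \<bullet> w = p"
      by (simp add: p_def w_def inner_diff_left)
    finally show ?thesis using vv by (simp add: M_def)
  qed
  have "p \<le> 0"
  proof (rule ccontr)
    assume "\<not> p \<le> 0"
    then have p: "p > 0" by simp
    have d: "0 \<le> d" unfolding d_def by (rule quad[OF wS])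
    \<comment> \<open>The minimiser would be \<open>- p / d\<close>; the added 1 covers
      \<open>d = 0\<close> and still gives a negative value.\<close>
    define t where "t = - p / (d + 1)"
    have "2 * t * p + t\<^sup>2 * d = - (p\<^sup>2 * (d + 2)) / (d + 1)\<^sup>2"
      using d by (simp add: t_def divide_simps) (simp add: power2_eq_square algebra_simps)
    also have "\<dots> < 0" using p d by (simp add: divide_neg_pos)
    finally show False using lin[of t] by simp
  qed
  then have "w = 0" unfolding p_def by (metis inner_eq_zero_iff inner_ge_zero order_antisym)
  then have "T v = M *\<^sub>R v" by (simp add: w_def)
  with vS v show thesis by (intro that[of v M]) auto
qed

text \<open>An orthonormal family of eigenvectors of largest cardinality must span: its orthogonal
  complement is invariant by self-adjointness, so if nonzero it would contain one more unit
  eigenvector.\<close>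

lemma selfadjoint_orthonormal_eigenbasis:
  fixes T :: "'a::euclidean_space \<Rightarrow> 'a"
  assumes T: "linear T" and sa: "\<And>x y. x \<bullet> T y = T x \<bullet> y"
  obtains B where "finite B" "pairwise orthogonal B" "\<And>v. v \<in> B \<Longrightarrow> norm v = 1"
    "\<And>v. v \<in> B \<Longrightarrow> \<exists>a. T v = a *\<^sub>R v" "span B = UNIV"
proof -
  let ?P = "\<lambda>B. pairwise orthogonal B \<and> (\<forall>v\<in>B. norm v = 1 \<and> (\<exists>a. T v = a *\<^sub>R v))"
  have fin: "finite B \<and> card B \<le> DIM('a)" if "?P B" for B
  proof (rule independent_bound, rule pairwise_orthogonal_independent)
    show "pairwise orthogonal B" "0 \<notin> B" using that by auto
  qed
  obtain B where B: "?P B" and max: "\<And>C. ?P C \<Longrightarrow> card C \<le> card B"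
    using ex_has_greatest_nat[of ?P "{}" card "Suc DIM('a)"] fin by (auto simp: le_imp_less_Suc)
  define S where "S = {x. \<forall>v\<in>B. v \<bullet> x = 0}"
  have "S = {0}"
  proof (rule ccontr)
    assume ne: "S \<noteq> {0}"
    have "subspace S" by (auto simp: S_def subspace_def inner_right_distrib)
    moreover have "T x \<in> S" if x: "x \<in> S" for x
      unfolding S_def
    proof (clarify)
      fix v assume v: "v \<in> B"
      then obtain a where "T v = a *\<^sub>R v" using B by blast
      then show "v \<bullet> T x = 0" using x v by (simp add: sa S_def)
    qed
    ultimately obtain v a where v: "v \<in> S" "norm v = 1" "T v = a *\<^sub>R v"
      using selfadjoint_eigenvector_in_subspace[OF T sa _ _ ne] by blast
    \<comment> \<open>A member of \<open>B\<close> lying in \<open>S\<close> would be orthogonal to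
      itself.\<close>
    have "v \<notin> B" using v by (auto simp: S_def)
    moreover have "?P (insert v B)"
      using B v by (auto simp: pairwise_insert orthogonal_def S_def inner_commute)
    from max[OF this] have "card (insert v B) \<le> card B" .
    ultimately show False using fin[OF B] by simp
  qed
  have "span B = UNIV"
  proof (rule ccontr)
    assume "span B \<noteq> UNIV"
    then have "span B \<subset> span UNIV" by auto
    then obtain x where x: "x \<noteq> 0" "\<And>y. y \<in> span B \<Longrightarrow> orthogonal x y"
      using orthogonal_to_subspace_exists_gen by blast
    then have "x \<in> S" by (auto simp: S_def orthogonal_def inner_commute span_base)
    with \<open>S = {0}\<close> x(1) show False by blast
  qed
  then show thesis using B fin[OF B] by (intro that[of B]) auto
qed

section \<open>Krylov vectors and roots of the characteristic polynomial\<close>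

text \<open>The witness is \<open>p(A) b\<close>. Symmetry moves each power of \<open>A\<close> onto
  the eigenvector, where it acts as a power of \<open>a\<close>.\<close>

lemma krylov_polynomial_combination:
  fixes A :: "real ^ 'n ^ 'n"
  assumes T: "transpose A = A" and p: "degree p < k"
  obtains y where "y \<in> krylov k A b"
    "\<And>v a. A *v v = a *\<^sub>R v \<Longrightarrow> v \<bullet> y = poly p a * (v \<bullet> b)"
proof -
  let ?y = "\<Sum>j<k. coeff p j *\<^sub>R (((*v) A) ^^ j) b"
  have "?y \<in> krylov k A b"
    unfolding krylov_def by (intro span_sum span_scale span_base imageI) simp
  moreover have "v \<bullet> ?y = poly p a * (v \<bullet> b)" if v: "A *v v = a *\<^sub>R v" for v a
  proof -
    have "v \<bullet> (((*v) A) ^^ j) b = a ^ j * (v \<bullet> b)" for j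
    proof (induction j)
      case (Suc j)
      have "v \<bullet> (((*v) A) ^^ Suc j) b = (A *v v) \<bullet> (((*v) A) ^^ j) b"
        by (simp add: dot_lmul_matrix[symmetric]) (metis T transpose_matrix_vector)
      with Suc v show ?case by simp
    qed simp
    then have "v \<bullet> ?y = (\<Sum>j<k. coeff p j * a ^ j) * (v \<bullet> b)"
      by (simp add: inner_sum_right sum_distrib_left sum_distrib_right ac_simps)
    also have "(\<Sum>j<k. coeff p j * a ^ j) = poly p a"
      unfolding poly_altdef using p
      by (intro sum.mono_neutral_right) (auto simp: coeff_eq_0 not_le)
    finally show ?thesis .
  qed
  ultimately show thesis by (rule that)
qed

lemma mat_vector_mult: "mat a *v v = a *\<^sub>R (v :: real ^ 'n)"
  by (simp add: vec_eq_iff matrix_vector_mult_def mat_def if_distrib[of "\<lambda>c. c * _"] cong: if_cong)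

text \<open>Links the determinant in \<open>sorted_eigenvalues\<close> with eigenvectors: a nonzero
  kernel vector of \<open>mat a - A\<close> exists exactly when that matrix is singular.\<close>

lemma eigenvalue_root:
  fixes A :: "real ^ 'n ^ 'n"
  shows "(\<exists>v. v \<noteq> 0 \<and> A *v v = a *\<^sub>R v) \<longleftrightarrow> det (mat a - A) = 0"
proof -
  have "(mat a - A) *v v = 0 \<longleftrightarrow> A *v v = a *\<^sub>R v" for v
    by (auto simp: matrix_vector_mult_diff_rdistrib mat_vector_mult)
  then show ?thesis
    using invertible_det_nz[of "mat a - A"] invertible_left_inverse[of "mat a - A"]
      matrix_left_invertible_ker[of "mat a - A"] by metis
qed

section \<open>Comparison of the iterate with a damped copy of the solution\<close>

theorem theorem9p1:
  fixes A :: "real ^ 'n ^ 'n" and b xstar :: "real ^ 'n" and \<Delta> \<mu> \<zeta> :: real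
    and lam :: "nat \<Rightarrow> real" and x :: "nat \<Rightarrow> real ^ 'n"
  assumes "symmetric_psd A"
    and "sorted_eigenvalues A lam"
    and "lam 1 < lam CARD('n)"
    and "\<Delta> > 0"
    and "trs_solution A b \<Delta> xstar"
    and "\<mu> > 0"
    and "(A + mat \<mu>) *v xstar = b"
    and "norm xstar = \<Delta>"
    and "x 0 = 0"
    and "\<And>k. k \<ge> 1 \<Longrightarrow> trs_lanczos_iterate k A b \<Delta> (x k)"
    and "\<zeta> = sqrt ((lam CARD('n) + \<mu>) / (lam 1 + \<mu>))"
  shows "\<forall>k\<ge>1.
      quad_obj A b (x k) - quad_obj A b xstar
        \<le> 6 * norm_const k (lam 1) (lam CARD('n)) \<mu> * (quad_obj A b (x 0) - quad_obj A b xstar)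
      \<and> norm_const k (lam 1) (lam CARD('n)) \<mu> \<le> 2 * ((\<zeta> - 1) / (\<zeta> + 1)) ^ k"
proof (intro allI impI conjI)
  fix k :: nat
  assume k: "k \<ge> 1"
  define n where "n = CARD('n)"
  have n: "n \<ge> 1" by (simp add: n_def Suc_leI)
  have trA: "transpose A = A" and psd: "\<And>v. 0 \<le> v \<bullet> (A *v v)"
    using assms(1) by (auto simp: symmetric_psd_def)
  have mono: "mono_on {1..n} lam" and det: "\<And>t. det (mat t - A) = (\<Prod>i\<in>{1..n}. t - lam i)"
    using assms(2) by (auto simp: sorted_eigenvalues_def n_def)
  have sa: "x \<bullet> (A *v y) = (A *v x) \<bullet> y" for x y
    by (simp add: dot_lmul_matrix[symmetric]) (metis trA transpose_matrix_vector)
  have l0: "0 \<le> lam 1"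
  proof -
    have "det (mat (lam 1) - A) = 0" using n by (auto simp: det)
    then obtain v where v: "v \<noteq> 0" "A *v v = lam 1 *\<^sub>R v" using eigenvalue_root by blast
    have "0 \<le> lam 1 * (v \<bullet> v)" using psd[of v] v by simp
    moreover have "v \<bullet> v > 0" using v by simp
    ultimately show ?thesis unfolding zero_le_mult_iff by linarith
  qed
  have lu: "lam 1 < lam n" using assms(3) by (simp add: n_def)
  define c where "c = norm_const k (lam 1) (lam n) \<mu>"
  note c = norm_const_eq[OF l0 lu \<open>\<mu> > 0\<close>, of k, folded c_def]
  show "norm_const k (lam 1) (lam CARD('n)) \<mu> \<le> 2 * ((\<zeta> - 1) / (\<zeta> + 1)) ^ k"
    using norm_const_le[OF l0 lu \<open>\<mu> > 0\<close>] assms(11) by (simp add: n_def)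

  obtain B where B: "finite B" "pairwise orthogonal B" "\<And>v. v \<in> B \<Longrightarrow> norm v = 1"
    and eig: "\<And>v. v \<in> B \<Longrightarrow> \<exists>a. A *v v = a *\<^sub>R v" and sp: "span B = UNIV"
    using selfadjoint_orthonormal_eigenbasis[of "(*v) A"] sa by (metis matrix_vector_mul_linear)
  obtain a where a: "\<And>v. v \<in> B \<Longrightarrow> A *v v = a v *\<^sub>R v" using eig by metis
  \<comment> \<open>Each \<open>a v\<close> is a root of the characteristic polynomial, hence listed
    in \<open>lam\<close>. So \<open>a v + \<mu>\<close> lies in the interval where \<open>q\<close>
    is controlled.\<close>
  have a_bounds: "lam 1 \<le> a v \<and> a v \<le> lam n" if v: "v \<in> B" for v
  proof -
    have "v \<noteq> 0" using B(3)[OF v] by auto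
    then have "det (mat (a v) - A) = 0" using a[OF v] eigenvalue_root by blast
    then obtain i where "i \<in> {1..n}" "a v = lam i" by (auto simp: det)
    then show ?thesis using mono_onD[OF mono, of 1 i] mono_onD[OF mono, of i n] n by auto
  qed
  \<comment> \<open>Parseval's identity, which reduces norms and objective values to sums over
    eigendirections.\<close>
  have inner_B: "x \<bullet> y = (\<Sum>v\<in>B. (v \<bullet> x) * (v \<bullet> y))" for x y :: "real ^ 'n"
  proof -
    have "(\<Sum>v\<in>B. (x \<bullet> v) *\<^sub>R v) \<bullet> y = (\<Sum>v\<in>B. (v \<bullet> x) * (v \<bullet> y))"
      by (simp add: inner_sum_left inner_commute[of x])
    then show ?thesis using orthonormal_basis_expand[OF B(2,3) _ B(1), of x] sp by simp
  qed
  have vA: "v \<bullet> (A *v x) = a v * (v \<bullet> x)" if "v \<in> B" for v x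
    by (simp add: sa a[OF that])
  have f_B: "quad_obj A b x = (\<Sum>v\<in>B. 1 / 2 * a v * (v \<bullet> x)\<^sup>2 - (v \<bullet> b) * (v \<bullet> x))" for x
    unfolding quad_obj_def inner_B[of x] inner_B[of b]
    by (simp add: vA sum_distrib_left sum_subtractf power2_eq_square ac_simps)
  have "b = A *v xstar + \<mu> *\<^sub>R xstar"
    unfolding assms(7)[symmetric]
    by (simp add: matrix_vector_mult_add_rdistrib mat_vector_mult)
  then have vb: "v \<bullet> b = (a v + \<mu>) * (v \<bullet> xstar)" if "v \<in> B" for v
    using vA[OF that] by (simp add: inner_add_right algebra_simps)

  define q where "q = qA c k (lam 1) (lam n) \<mu>"
  have "poly (1 - q) 0 = 0" using c(4) by (simp add: q_def)
  \<comment> \<open>Splitting off the root 0 of \<open>1 - q\<close> lowers the degree below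
    \<open>k\<close>, as membership in \<open>krylov k A b\<close> requires.\<close>
  then obtain p where p: "1 - q = [:0, 1:] * p"
    using poly_eq_0_iff_dvd[of "1 - q" 0] by (auto elim: dvdE)
  have "degree (1 - q) \<le> k"
    unfolding q_def by (intro degree_diff_le degree_qA_le) simp
  then have dp: "degree p < k"
    using k unfolding p by (cases "p = 0") (auto simp: degree_mult_eq)
  \<comment> \<open>The shift makes \<open>y = p(A + \<mu> I) b\<close>; as
    \<open>b = (A + \<mu> I) xstar\<close>, this is
    \<open>(1 - q)(A + \<mu> I) xstar\<close>.\<close>
  then have "degree (pcompose p [:\<mu>, 1:]) < k" by (simp add: degree_pcompose)
  then obtain y where y: "y \<in> krylov k A b"
    and vy: "\<And>v a. A *v v = a *\<^sub>R v \<Longrightarrow> v \<bullet> y = poly (pcompose p [:\<mu>, 1:]) a * (v \<bullet> b)"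
    using krylov_polynomial_combination[OF trA] by metis
  define Q where "Q v = poly q (a v + \<mu>)" for v
  have vy: "v \<bullet> y = (1 - Q v) * (v \<bullet> xstar)" if "v \<in> B" for v
  proof -
    have "1 - Q v = (a v + \<mu>) * poly p (a v + \<mu>)"
      using arg_cong[OF p, of "\<lambda>r. poly r (a v + \<mu>)"] by (simp add: Q_def)
    then show ?thesis using vy[OF a[OF that]] vb[OF that]
      by (simp add: poly_pcompose add.commute)
  qed
  have Q: "0 \<le> Q v" "Q v \<le> 2 * c" "Q v \<le> 1" if "v \<in> B" for v
    using poly_qA_bounds[OF lu, of c \<mu> "a v + \<mu>" k] a_bounds[OF that] c(2,3)
    unfolding Q_def q_def by linarith+

  have "y \<bullet> y \<le> xstar \<bullet> xstar"
    unfolding inner_B[of y] inner_B[of xstar]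
  proof (rule sum_mono)
    fix v assume v: "v \<in> B"
    have "(1 - Q v) * (1 - Q v) \<le> 1" using Q[OF v] by (intro mult_le_one) auto
    then have "((1 - Q v) * (1 - Q v)) * ((v \<bullet> xstar) * (v \<bullet> xstar)) \<le> 1 * ((v \<bullet> xstar) * (v \<bullet> xstar))"
      by (intro mult_right_mono) auto
    then show "(v \<bullet> y) * (v \<bullet> y) \<le> (v \<bullet> xstar) * (v \<bullet> xstar)"
      by (simp add: vy[OF v] ac_simps)
  qed
  then have "norm y \<le> \<Delta>" unfolding assms(8)[symmetric] by (simp add: norm_le)
  with y have "quad_obj A b (x k) \<le> quad_obj A b y"
    using assms(10)[OF k] by (auto simp: trs_lanczos_iterate_def is_arg_min_def not_less)
  \<comment> \<open>After inserting \<open>vb\<close>, the terms \<open>a v * Q v\<close> from the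
    quadratic and the linear part cancel, so only \<open>\<mu>\<close> multiplies the first power of
    \<open>Q v\<close>.\<close>
  moreover have "quad_obj A b y - quad_obj A b xstar
      = (\<Sum>v\<in>B. (1 / 2 * a v * (Q v)\<^sup>2 + \<mu> * Q v) * (v \<bullet> xstar)\<^sup>2)"
    unfolding f_B sum_subtractf[symmetric]
    by (rule sum.cong) (auto simp: vy vb power2_eq_square algebra_simps)
  \<comment> \<open>The same formula with \<open>Q v = 1\<close>, since full damping gives the zero
    vector.\<close>
  moreover have f0: "quad_obj A b (x 0) - quad_obj A b xstar
      = (\<Sum>v\<in>B. (1 / 2 * a v + \<mu>) * (v \<bullet> xstar)\<^sup>2)"
    unfolding f_B sum_subtractf[symmetric] assms(9)
    by (rule sum.cong) (auto simp: vb power2_eq_square algebra_simps)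
  moreover have "(\<Sum>v\<in>B. (1 / 2 * a v * (Q v)\<^sup>2 + \<mu> * Q v) * (v \<bullet> xstar)\<^sup>2)
      \<le> (\<Sum>v\<in>B. 6 * c * ((1 / 2 * a v + \<mu>) * (v \<bullet> xstar)\<^sup>2))"
  proof (rule sum_mono)
    fix v assume v: "v \<in> B"
    have a0: "0 \<le> a v" using a_bounds[OF v] l0 by linarith
    \<comment> \<open>Both weights fall under one factor:
      \<open>(Q v)\<^sup>2 \<le> Q v \<le> 2 * c \<le> 6 * c\<close>, the last because
      \<open>c\<close> is positive.\<close>
    have "(Q v)\<^sup>2 \<le> Q v" using Q[OF v] by (simp add: power2_eq_square mult_left_le)
    then have Q2: "(Q v)\<^sup>2 \<le> 6 * c" "Q v \<le> 6 * c" using Q[OF v] c(2) by linarith+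
    have "1 / 2 * a v * (Q v)\<^sup>2 + \<mu> * Q v \<le> 1 / 2 * a v * (6 * c) + \<mu> * (6 * c)"
      using a0 \<open>\<mu> > 0\<close> by (intro add_mono mult_left_mono Q2) auto
    also have "\<dots> = 6 * c * (1 / 2 * a v + \<mu>)" by (simp add: algebra_simps)
    finally show "(1 / 2 * a v * (Q v)\<^sup>2 + \<mu> * Q v) * (v \<bullet> xstar)\<^sup>2
        \<le> 6 * c * ((1 / 2 * a v + \<mu>) * (v \<bullet> xstar)\<^sup>2)"
      unfolding mult.assoc[symmetric, of "6 * c"] by (rule mult_right_mono) simp
  qed
  ultimately show "quad_obj A b (x k) - quad_obj A b xstar
      \<le> 6 * norm_const k (lam 1) (lam CARD('n)) \<mu> * (quad_obj A b (x 0) - quad_obj A b xstar)"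
    unfolding n_def[symmetric] c_def[symmetric] sum_distrib_left[symmetric] f0 by linarith
qed

end
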